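(* Let $f(t)$ be a real univariate polynomial of degree $d\le4$ that is strictly CLC for $t\ge0$. If $A$ is a real square matrix whose characteristic polynomial is $\chi_A(t)=f(t)$, then the linear time-invariant system $\frac{dx}{dt}=Ax$ is stable.
   Context: A univariate polynomial $h$ is log-concave on $[0,\infty)$ if $h(t)>0$ and $\frac{d^2}{dt^2}\log h(t)\le0$ for all $t\ge0$, and strictly log-concave there if moreover $\frac{d^2}{dt^2}\log h(t)<0$ for all $t\ge0$. A univariate polynomial $f$ of degree $d$ is strictly CLC (strictly completely log-concave) for $t\ge0$ if $f^{(m)}$ is log-concave on $[0,\infty)$ for all $0\le m\le d$ and strictly log-concave on $[0,\infty)$ for all $0\le m\le d-1$. The system $\dot x=Ax$ (or the matrix $A$) is called stable if every eigenvalue of $A$ has negative real part. *)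

theory Defs
  imports "HOL-Analysis.Derivative" "Jordan_Normal_Form.Char_Poly"
begin

definition log_concave_nonneg :: "real poly \<Rightarrow> bool" where
  "log_concave_nonneg h \<longleftrightarrow>
     (\<forall>t\<ge>0. poly h t > 0 \<and> (deriv ^^ 2) (\<lambda>s. ln (poly h s)) t \<le> 0)"

definition strictly_log_concave_nonneg :: "real poly \<Rightarrow> bool" where
  "strictly_log_concave_nonneg h \<longleftrightarrow>
     log_concave_nonneg h \<and> (\<forall>t\<ge>0. (deriv ^^ 2) (\<lambda>s. ln (poly h s)) t < 0)"

definition strictly_CLC_nonneg :: "real poly \<Rightarrow> bool" where
  "strictly_CLC_nonneg f \<longleftrightarrow>
     (\<forall>m\<le>degree f. log_concave_nonneg ((pderiv ^^ m) f)) \<and>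
     (\<forall>m<degree f. strictly_log_concave_nonneg ((pderiv ^^ m) f))"

text \<open>Stability concerns the complex eigenvalues of the real matrix, hence the embedding.\<close>

definition stable_matrix :: "real mat \<Rightarrow> bool" where
  "stable_matrix A \<longleftrightarrow> (\<forall>z. eigenvalue (map_mat complex_of_real A) z \<longrightarrow> Re z < 0)"

end

theory Submission
  imports Defs
begin

text \<open>
  Log-concavity of a derivative $f^{(m)}$ is the Turan inequality
  $f^{(m)} f^{(m+2)} \le (f^{(m+1)})^2$. As it is assumed at every $x \ge 0$, and not only at the
  origin, the Taylor expansion of $f$ may be centred at the real part of a putative root.

  Suppose that $f(x + iy) = 0$ with $x \ge 0$, and write $D_k = f^{(k)}(x)$. As $D_0 > 0$, we have
  $y \ne 0$; put $s = y^2$. In degree at most four the imaginary and real parts of the equation are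
  \[ D_1 = D_3 s / 6, \qquad D_0 - D_2 s / 2 + D_4 s^2 / 24 = 0. \]
  Multiply the second one by $D_2$. The Turan inequalities bound $D_0 D_2$ by
  $D_1^2 = D_3^2 s^2 / 36$, bound $D_2^2 s$ from below by $D_1 D_3 s = D_3^2 s^2 / 6$, and bound
  $D_2 D_4$ by $D_3^2$. So the left-hand side is at most
  $(1/36 - 1/12 + 1/24) D_3^2 s^2 = - D_3^2 s^2 / 72 \le 0$. It is even negative, since the
  inequality $D_0 D_2 < D_1^2$ is strict: this contradicts the equation. (For constant $f$, where
  strictness is not assumed, $f > 0$ has no root at all.)
  Finally, the complex eigenvalues of a matrix are the roots of its characteristic polynomial.
\<close>

text \<open>The logarithm can be differentiated twice because positivity of a polynomial at a point
  persists in a neighbourhood; this matters at the end point $0$ of the half-line, where $h > 0$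
  is assumed on one side only.\<close>

lemma second_deriv_ln_poly:
  fixes h :: "real poly"
  assumes pos: "poly h t > 0"
  shows "(deriv ^^ 2) (\<lambda>s. ln (poly h s)) t =
    (poly h t * poly (pderiv (pderiv h)) t - (poly (pderiv h) t)\<^sup>2) / (poly h t)\<^sup>2"
proof -
  have "open {s. poly h s > 0}"
    by (intro open_Collect_less continuous_intros)
  then have near: "eventually (\<lambda>s. poly h s > 0) (nhds t)"
    using pos eventually_nhds_in_open by fastforce
  have "eventually (\<lambda>s. deriv (\<lambda>s. ln (poly h s)) s = poly (pderiv h) s / poly h s) (nhds t)"
    using near
  proof eventually_elim
    case (elim s)
    then show ?case
      by (intro DERIV_imp_deriv) (auto intro!: derivative_eq_intros)
  qed
  then have "deriv (deriv (\<lambda>s. ln (poly h s))) t = deriv (\<lambda>s. poly (pderiv h) s / poly h s) t"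
    by (intro deriv_cong_ev) auto
  also have "\<dots> = (poly h t * poly (pderiv (pderiv h)) t - (poly (pderiv h) t)\<^sup>2) / (poly h t)\<^sup>2"
    using pos by (intro DERIV_imp_deriv)
      (auto intro!: derivative_eq_intros simp: power2_eq_square algebra_simps)
  finally show ?thesis
    by (simp add: numeral_2_eq_2)
qed

lemma log_concave_nonneg_turan:
  assumes "log_concave_nonneg h" "t \<ge> 0"
  shows "poly h t * poly (pderiv (pderiv h)) t \<le> (poly (pderiv h) t)\<^sup>2"
proof -
  have pos: "poly h t > 0" and "(deriv ^^ 2) (\<lambda>s. ln (poly h s)) t \<le> 0"
    using assms by (auto simp: log_concave_nonneg_def)
  then show ?thesis
    by (simp add: second_deriv_ln_poly[OF pos] divide_le_0_iff)
qed

lemma strictly_log_concave_nonneg_turan: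
  assumes "strictly_log_concave_nonneg h" "t \<ge> 0"
  shows "poly h t * poly (pderiv (pderiv h)) t < (poly (pderiv h) t)\<^sup>2"
proof -
  have pos: "poly h t > 0" and "(deriv ^^ 2) (\<lambda>s. ln (poly h s)) t < 0"
    using assms by (auto simp: strictly_log_concave_nonneg_def log_concave_nonneg_def)
  then show ?thesis
    by (simp add: second_deriv_ln_poly[OF pos] divide_less_0_iff)
qed

lemma strictly_CLC_nonneg_turan:
  assumes clc: "strictly_CLC_nonneg f" and t: "t \<ge> 0"
  shows "poly ((pderiv ^^ m) f) t * poly ((pderiv ^^ Suc (Suc m)) f) t
    \<le> (poly ((pderiv ^^ Suc m) f) t)\<^sup>2"
proof (cases "m \<le> degree f")
  case True
  then have "log_concave_nonneg ((pderiv ^^ m) f)"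
    using clc by (simp add: strictly_CLC_nonneg_def)
  from log_concave_nonneg_turan[OF this t] show ?thesis by simp
next
  case False
  then have "(pderiv ^^ m) f = 0"
    by (intro poly_eqI) (simp add: coeff_higher_pderiv coeff_eq_0)
  then show ?thesis by simp
qed

text \<open>Taylor's formula at the real part of the argument: even powers of $iy$ are real and odd ones
  are imaginary, so the derivatives at $x$ separate by parity.\<close>

lemma quartic_taylor_complex:
  fixes f :: "real poly" and x y :: real
  assumes "degree f \<le> 4"
  shows "poly (map_poly complex_of_real f) (Complex x y) =
    Complex
      (poly f x - poly ((pderiv ^^ 2) f) x * y\<^sup>2 / 2 + poly ((pderiv ^^ 4) f) x * y ^ 4 / 24)
      (y * (poly (pderiv f) x - poly ((pderiv ^^ 3) f) x * y\<^sup>2 / 6))"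
proof -
  define a where "a = coeff f"
  have f: "f = [:a 0, a 1, a 2, a 3, a 4:]"
  proof (intro poly_eqI)
    fix k
    show "coeff f k = coeff [:a 0, a 1, a 2, a 3, a 4:] k"
      using assms
      by (auto simp: a_def coeff_pCons coeff_eq_0 numeral_eq_Suc split: nat.splits)
  qed
  have "poly (map_poly complex_of_real f) (Complex x y) =
    of_real (a 0) + Complex x y * (of_real (a 1) + Complex x y * (of_real (a 2)
      + Complex x y * (of_real (a 3) + Complex x y * of_real (a 4))))"
    by (subst f) (simp add: of_real_hom.map_poly_pCons_hom)
  then show ?thesis
    by (subst (2 3 4 5 6) f)
      (simp add: complex_eq_iff pderiv_pCons numeral_eq_Suc field_simps)
qed

theorem strictly_CLC_nonneg_quartic_root_Re_neg:
  fixes f :: "real poly" and z :: complex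
  assumes deg: "degree f \<le> 4" and clc: "strictly_CLC_nonneg f"
    and root: "poly (map_poly complex_of_real f) z = 0"
  shows "Re z < 0"
proof (rule ccontr)
  assume "\<not> Re z < 0"
  then obtain x y where z: "z = Complex x y" and x: "x \<ge> 0"
    by (cases z) auto
  define D where "D k = poly ((pderiv ^^ k) f) x" for k
  define s where "s = y\<^sup>2"
  have turan: "D m * D (Suc (Suc m)) \<le> (D (Suc m))\<^sup>2" for m
    unfolding D_def by (rule strictly_CLC_nonneg_turan[OF clc x])
  have D0: "D 0 > 0"
    using clc x by (auto simp: strictly_CLC_nonneg_def log_concave_nonneg_def D_def)
  have re: "D 0 - D 2 * s / 2 + D 4 * s\<^sup>2 / 24 = 0" and im: "y * (D 1 - D 3 * s / 6) = 0"
    using root by (simp_all add: z quartic_taylor_complex[OF deg] D_def s_def complex_eq_iff)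
  have "y \<noteq> 0"
    using re D0 by (auto simp: s_def)
  then have s: "s > 0" and D1: "D 1 = D 3 * s / 6"
    using im by (auto simp: s_def)
  have "degree f \<noteq> 0"
  proof
    assume "degree f = 0"
    then obtain c where "f = [:c:]" by (rule degree_eq_zeroE)
    then have "D 2 = 0" "D 4 = 0"
      by (simp_all add: D_def numeral_eq_Suc pderiv_pCons)
    with re D0 show False by simp
  qed
  then have "strictly_log_concave_nonneg f"
    using clc by (force simp: strictly_CLC_nonneg_def)
  from strictly_log_concave_nonneg_turan[OF this x] have "D 0 * D 2 < (D 1)\<^sup>2"
    by (simp add: D_def numeral_2_eq_2)
  then have b0: "D 0 * D 2 < (D 3)\<^sup>2 * s\<^sup>2 / 36"
    unfolding D1 by (simp add: power_mult_distrib power_divide)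
  have "(D 3 * s / 6) * D 3 * s \<le> (D 2)\<^sup>2 * s"
    unfolding D1[symmetric] using turan[of 1] s
    by (intro mult_right_mono) (simp_all add: numeral_eq_Suc)
  then have b2: "(D 3)\<^sup>2 * s\<^sup>2 / 6 \<le> (D 2)\<^sup>2 * s"
    by (simp add: power2_eq_square mult_ac)
  have b4: "D 2 * D 4 * s\<^sup>2 \<le> (D 3)\<^sup>2 * s\<^sup>2"
    using turan[of 2] by (intro mult_right_mono) (simp_all add: numeral_eq_Suc)
  have "D 0 * D 2 - (D 2)\<^sup>2 * s / 2 + D 2 * D 4 * s\<^sup>2 / 24
      = D 2 * (D 0 - D 2 * s / 2 + D 4 * s\<^sup>2 / 24)"
    by (simp add: algebra_simps power2_eq_square)
  also have "\<dots> = 0" by (simp add: re)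
  finally have "D 0 * D 2 - (D 2)\<^sup>2 * s / 2 + D 2 * D 4 * s\<^sup>2 / 24 = 0" .
  moreover have "(D 3)\<^sup>2 * s\<^sup>2 \<ge> 0" by simp
  ultimately show False
    using b0 b2 b4 by linarith
qed

theorem theorem5p2:
  fixes f :: "real poly" and A :: "real mat" and n :: nat
  assumes "degree f \<le> 4"
    and "strictly_CLC_nonneg f"
    and "A \<in> carrier_mat n n"
    and "char_poly A = f"
  shows "stable_matrix A"
  unfolding stable_matrix_def
proof (intro allI impI)
  fix z assume ev: "eigenvalue (map_mat complex_of_real A) z"
  have "map_mat complex_of_real A \<in> carrier_mat n n"
    using assms(3) by simp
  then have "poly (char_poly (map_mat complex_of_real A)) z = 0"
    using ev eigenvalue_root_char_poly by blast
  moreover have "char_poly (map_mat complex_of_real A) = map_poly complex_of_real (char_poly A)"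
    by (rule of_real_hom.char_poly_hom[OF assms(3)])
  ultimately have "poly (map_poly complex_of_real f) z = 0"
    using assms(4) by simp
  then show "Re z < 0"
    by (rule strictly_CLC_nonneg_quartic_root_Re_neg[OF assms(1,2)])
qed

end
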